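(* Let $A$ be an $H^*$-Galois left $H$-module algebra over a finite dimensional Hopf algebra $H$ and let $E=\operatorname{End}_HA$. Suppose that $H$ is cocommutative and $A$ is central simple. If $V\subset A$ is an $H$-invariant subspace which generates the algebra $A$ and $\iota:V\to A$ is the inclusion map, then $E$ is generated as an algebra by the operators $\Phi_{\tau\iota}$ with $\tau\in D(V^* )$.
   Context: $k$ is a field; unadorned $\otimes$, $\operatorname{Hom}$, $\operatorname{End}$ are over $k$. $H$ is a finite dimensional Hopf algebra over $k$ with $\Delta h=\sum_{(h)}h'\otimes h''$, counit $\varepsilon$, antipode $S$. Algebras are extensions of $k$ (so $A\neq0$, $k=k1_A\subset A$). A left $H$-module algebra $A$ is $H^*$-Galois if the map $\pi:A\otimes H\to\operatorname{End}A$, $\pi(a\otimes h)(b)=a(hb)$, is bijective; equivalently (known fact) if any one of the maps $\pi'(a\otimes h)(b)=(hb)a$ from $A\otimes H$ to $\operatorname{End}A$, $\gamma(a\otimes b)(h)=a(hb)$, $\gamma'(a\otimes b)(h)=(ha)b$ from $A\otimes A$ to $\operatorname{Hom}(H,A)\cong A\otimes H^*$ is bijective. Then $\dim A<\infty$ and $A^H=k$. $E=\operatorname{End}_HA$ is the algebra of $H$-module endomorphisms of $A$. For a finite dimensional left $H$-module $V$, $V^*$ is the dual space with $H$-action $\langle h\xi,v\rangle=\langle\xi,S(h)v\rangle$ (here $S^2=\operatorname{id}$ as $H$ is cocommutative), and $D(W)=\operatorname{Hom}_H(W,A)$. For $\sigma\in D(V)$, $\tau\in D(V^* )$ and dual bases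 $\{e_i\}$, $\{e_i^*\}$ of $V$ and $V^*$, the operator $\Phi_{\tau\sigma}:A\to A$ is defined by $\Phi_{\tau\sigma}(a)=\sum_i\tau(e_i^* )\,a\,\sigma(e_i)$ for $a\in A$; it belongs to $E$. *)

theory Defs
  imports Complex_Main "HOL-Library.Multiset"
begin

section \<open>Algebras\<close>

text \<open>A \<open>k\<close>-algebra is a unital ring, here never zero since \<open>0 \<noteq> 1\<close> in \<open>ring_1\<close>, with a
  compatible vector space structure. The embedding of \<open>k\<close> is \<open>c \<mapsto> c *s 1\<close>.\<close>

locale k_algebra = vector_space scale
  for scale :: "'k::field \<Rightarrow> 'a::ring_1 \<Rightarrow> 'a" (infixr \<open>*s\<close> 75) +
  assumes scale_mult_left: "(c *s x) * y = c *s (x * y)"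
    and scale_mult_right: "x * (c *s y) = c *s (x * y)"

definition central_algebra :: "('k::field \<Rightarrow> 'a::ring_1 \<Rightarrow> 'a) \<Rightarrow> bool" where
  "central_algebra sA \<longleftrightarrow> {z. \<forall>a. z * a = a * z} = range (\<lambda>c. sA c 1)"

definition two_sided_ideal :: "'a::ring_1 set \<Rightarrow> bool" where
  "two_sided_ideal I \<longleftrightarrow> 0 \<in> I \<and> (\<forall>x\<in>I. \<forall>y\<in>I. x + y \<in> I)
     \<and> (\<forall>x\<in>I. \<forall>a. a * x \<in> I \<and> x * a \<in> I)"

definition simple_algebra :: "('k::field \<Rightarrow> 'a::ring_1 \<Rightarrow> 'a) \<Rightarrow> bool" where
  "simple_algebra sA \<longleftrightarrow> (\<forall>I :: 'a set. two_sided_ideal I \<longrightarrow> I = {0} \<or> I = UNIV)"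

definition central_simple :: "('k::field \<Rightarrow> 'a::ring_1 \<Rightarrow> 'a) \<Rightarrow> bool" where
  "central_simple sA \<longleftrightarrow> k_algebra sA \<and> central_algebra sA \<and> simple_algebra sA"

text \<open>The unital subalgebra generated by a set. The operations are parameters because this is used
  both in \<open>A\<close> and in \<open>End A\<close>, where the product is composition.\<close>

inductive_set generated_subalgebra ::
  "('a \<Rightarrow> 'a \<Rightarrow> 'a) \<Rightarrow> ('a \<Rightarrow> 'a \<Rightarrow> 'a) \<Rightarrow> 'a \<Rightarrow> ('k \<Rightarrow> 'a \<Rightarrow> 'a) \<Rightarrow> 'a set \<Rightarrow> 'a set"
  for plus times one scale X
  where
    base: "x \<in> X \<Longrightarrow> x \<in> generated_subalgebra plus times one scale X"
  | one: "one \<in> generated_subalgebra plus times one scale X"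
  | plus: "\<lbrakk>x \<in> generated_subalgebra plus times one scale X;
            y \<in> generated_subalgebra plus times one scale X\<rbrakk>
           \<Longrightarrow> plus x y \<in> generated_subalgebra plus times one scale X"
  | times: "\<lbrakk>x \<in> generated_subalgebra plus times one scale X;
            y \<in> generated_subalgebra plus times one scale X\<rbrakk>
           \<Longrightarrow> times x y \<in> generated_subalgebra plus times one scale X"
  | scale: "x \<in> generated_subalgebra plus times one scale X
           \<Longrightarrow> scale c x \<in> generated_subalgebra plus times one scale X"

definition algebra_generated ::
  "('k::field \<Rightarrow> 'a::ring_1 \<Rightarrow> 'a) \<Rightarrow> 'a set \<Rightarrow> 'a set" where
  "algebra_generated sA = generated_subalgebra (+) (*) 1 sA"

definition operator_algebra_generated ::
  "('k::field \<Rightarrow> 'a::ring_1 \<Rightarrow> 'a) \<Rightarrow> ('a \<Rightarrow> 'a) set \<Rightarrow> ('a \<Rightarrow> 'a) set" where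
  "operator_algebra_generated sA =
     generated_subalgebra (\<lambda>f g a. f a + g a) (\<circ>) id (\<lambda>c f a. sA c (f a))"


section \<open>Tensor products\<close>

text \<open>A multiset of pairs \<open>(x, y)\<close> stands for the formal sum of the tensors \<open>x \<otimes> y\<close>. Multisets
  form the free commutative monoid, and \<open>V \<otimes> W\<close> is its quotient by the least congruence making
  \<open>(x, y) \<mapsto> x \<otimes> y\<close> biadditive and \<open>k\<close>-balanced (scalars are absorbed into a factor). Adding
  \<open>0 \<otimes> y = 0\<close> is needed since a monoid congruence has no cancellation; the quotient is then a
  group.\<close>

inductive sum_congruence ::
  "('t multiset \<Rightarrow> 't multiset \<Rightarrow> bool) \<Rightarrow> 't multiset \<Rightarrow> 't multiset \<Rightarrow> bool"
  for R
  where
    gen: "R s t \<Longrightarrow> sum_congruence R s t"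
  | refl: "sum_congruence R t t"
  | sym: "sum_congruence R s t \<Longrightarrow> sum_congruence R t s"
  | trans: "\<lbrakk>sum_congruence R s t; sum_congruence R t u\<rbrakk> \<Longrightarrow> sum_congruence R s u"
  | add: "\<lbrakk>sum_congruence R s t; sum_congruence R s' t'\<rbrakk> \<Longrightarrow> sum_congruence R (s + s') (t + t')"

inductive tensor_rel ::
  "('k \<Rightarrow> 'v::ab_group_add \<Rightarrow> 'v) \<Rightarrow> ('k \<Rightarrow> 'w::ab_group_add \<Rightarrow> 'w) \<Rightarrow>
   ('v \<times> 'w) multiset \<Rightarrow> ('v \<times> 'w) multiset \<Rightarrow> bool"
  for sV sW
  where
    "tensor_rel sV sW {#(x + x', y)#} {#(x, y), (x', y)#}"
  | "tensor_rel sV sW {#(x, y + y')#} {#(x, y), (x, y')#}"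
  | "tensor_rel sV sW {#(sV c x, y)#} {#(x, sW c y)#}"
  | "tensor_rel sV sW {#(0, y)#} {#}"

definition tensor_eq ::
  "('k \<Rightarrow> 'v::ab_group_add \<Rightarrow> 'v) \<Rightarrow> ('k \<Rightarrow> 'w::ab_group_add \<Rightarrow> 'w) \<Rightarrow>
   ('v \<times> 'w) multiset \<Rightarrow> ('v \<times> 'w) multiset \<Rightarrow> bool" where
  "tensor_eq sV sW = sum_congruence (tensor_rel sV sW)"

definition tensor_product ::
  "('k \<Rightarrow> 'v::ab_group_add \<Rightarrow> 'v) \<Rightarrow> ('k \<Rightarrow> 'w::ab_group_add \<Rightarrow> 'w) \<Rightarrow>
   ('v \<times> 'w) multiset set set" where
  "tensor_product sV sW = UNIV // {(s, t). tensor_eq sV sW s t}"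

inductive tensor3_rel ::
  "('k \<Rightarrow> 'v::ab_group_add \<Rightarrow> 'v) \<Rightarrow> ('v \<times> 'v \<times> 'v) multiset \<Rightarrow> ('v \<times> 'v \<times> 'v) multiset \<Rightarrow> bool"
  for sV
  where
    "tensor3_rel sV {#(x + x', y, z)#} {#(x, y, z), (x', y, z)#}"
  | "tensor3_rel sV {#(x, y + y', z)#} {#(x, y, z), (x, y', z)#}"
  | "tensor3_rel sV {#(x, y, z + z')#} {#(x, y, z), (x, y, z')#}"
  | "tensor3_rel sV {#(sV c x, y, z)#} {#(x, sV c y, z)#}"
  | "tensor3_rel sV {#(x, sV c y, z)#} {#(x, y, sV c z)#}"
  | "tensor3_rel sV {#(0, y, z)#} {#}"

definition tensor3_eq ::
  "('k \<Rightarrow> 'v::ab_group_add \<Rightarrow> 'v) \<Rightarrow>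
   ('v \<times> 'v \<times> 'v) multiset \<Rightarrow> ('v \<times> 'v \<times> 'v) multiset \<Rightarrow> bool" where
  "tensor3_eq sV = sum_congruence (tensor3_rel sV)"


section \<open>Hopf algebras and module algebras\<close>

text \<open>The comultiplication is given by a representative \<open>\<Delta> h\<close>, in the sense of Sweedler's notation,
  of an element of \<open>H \<otimes> H\<close>, so that \<open>\<Sum>(x, y)\<in>#\<Delta> h. F x y\<close> is the Sweedler sum
  \<open>\<Sum>\<^sub>(\<^sub>h\<^sub>) F h' h''\<close>. The representative is arbitrary: the axioms compare
  representatives only up to equality in the tensor product.\<close>

locale hopf_algebra = k_algebra scale
  for scale :: "'k::field \<Rightarrow> 'h::ring_1 \<Rightarrow> 'h" (infixr \<open>*s\<close> 75) +
  fixes \<Delta> :: "'h \<Rightarrow> ('h \<times> 'h) multiset"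
    and \<epsilon> :: "'h \<Rightarrow> 'k"
    and S :: "'h \<Rightarrow> 'h"
  assumes comult_add: "tensor_eq scale scale (\<Delta> (g + h)) (\<Delta> g + \<Delta> h)"
    and comult_scale:
      "tensor_eq scale scale (\<Delta> (c *s h)) (image_mset (\<lambda>(x, y). (c *s x, y)) (\<Delta> h))"
    and coassoc:
      "tensor3_eq scale
         (\<Sum>(x, y)\<in>#\<Delta> h. image_mset (\<lambda>(x', x''). (x', x'', y)) (\<Delta> x))
         (\<Sum>(x, y)\<in>#\<Delta> h. image_mset (\<lambda>(y', y''). (x, y', y'')) (\<Delta> y))"
    and counit_linear: "Vector_Spaces.linear scale (*) \<epsilon>"
    and counit_left: "(\<Sum>(x, y)\<in>#\<Delta> h. \<epsilon> x *s y) = h"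
    and counit_right: "(\<Sum>(x, y)\<in>#\<Delta> h. \<epsilon> y *s x) = h"
    and comult_one: "tensor_eq scale scale (\<Delta> 1) {#(1, 1)#}"
    and comult_mult:
      "tensor_eq scale scale (\<Delta> (g * h))
         (\<Sum>(x, y)\<in>#\<Delta> g. image_mset (\<lambda>(x', y'). (x * x', y * y')) (\<Delta> h))"
    and counit_one: "\<epsilon> 1 = 1"
    and counit_mult: "\<epsilon> (g * h) = \<epsilon> g * \<epsilon> h"
    and antipode_linear: "Vector_Spaces.linear scale scale S"
    and antipode_left: "(\<Sum>(x, y)\<in>#\<Delta> h. S x * y) = \<epsilon> h *s 1"
    and antipode_right: "(\<Sum>(x, y)\<in>#\<Delta> h. x * S y) = \<epsilon> h *s 1"

definition finite_dimensional :: "('k::field \<Rightarrow> 'v::ab_group_add \<Rightarrow> 'v) \<Rightarrow> bool" where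
  "finite_dimensional sV \<longleftrightarrow> (\<exists>B. finite_dimensional_vector_space sV B)"

definition cocommutative ::
  "('k::field \<Rightarrow> 'h::ring_1 \<Rightarrow> 'h) \<Rightarrow> ('h \<Rightarrow> ('h \<times> 'h) multiset) \<Rightarrow> bool" where
  "cocommutative sH \<Delta> \<longleftrightarrow> (\<forall>h. tensor_eq sH sH (\<Delta> h) (image_mset prod.swap (\<Delta> h)))"

locale module_algebra =
  H: hopf_algebra sH \<Delta> \<epsilon> S + A: k_algebra sA
  for sH :: "'k::field \<Rightarrow> 'h::ring_1 \<Rightarrow> 'h"
    and \<Delta> :: "'h \<Rightarrow> ('h \<times> 'h) multiset"
    and \<epsilon> :: "'h \<Rightarrow> 'k"
    and S :: "'h \<Rightarrow> 'h"
    and sA :: "'k \<Rightarrow> 'a::ring_1 \<Rightarrow> 'a" +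
  fixes act :: "'h \<Rightarrow> 'a \<Rightarrow> 'a"
  assumes act_linear: "Vector_Spaces.linear sA sA (act h)"
    and act_add: "act (g + h) a = act g a + act h a"
    and act_scale: "act (sH c h) a = sA c (act h a)"
    and act_one: "act 1 a = a"
    and act_mult: "act (g * h) a = act g (act h a)"
    and act_on_mult: "act h (a * b) = (\<Sum>(x, y)\<in>#\<Delta> h. act x a * act y b)"
    and act_on_one: "act h 1 = sA (\<epsilon> h) 1"

text \<open>\<open>galois_map act\<close> is \<open>\<pi>\<close> on formal sums; it is constant on classes (shown below), so
  \<open>the_elem\<close> of the image of a class is the value of the induced map \<open>A \<otimes> H \<rightarrow> End A\<close>.\<close>

definition galois_map ::
  "('h \<Rightarrow> 'a \<Rightarrow> 'a) \<Rightarrow> ('a::ring_1 \<times> 'h::ring_1) multiset \<Rightarrow> 'a \<Rightarrow> 'a" where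
  "galois_map act t = (\<lambda>b. \<Sum>(a, h)\<in>#t. a * act h b)"

definition dual_galois ::
  "('k::field \<Rightarrow> 'h::ring_1 \<Rightarrow> 'h) \<Rightarrow> ('k \<Rightarrow> 'a::ring_1 \<Rightarrow> 'a) \<Rightarrow> ('h \<Rightarrow> 'a \<Rightarrow> 'a) \<Rightarrow> bool" where
  "dual_galois sH sA act \<longleftrightarrow>
     bij_betw (\<lambda>X. the_elem (galois_map act ` X)) (tensor_product sA sH)
       {f. Vector_Spaces.linear sA sA f}"

lemma (in module_algebra) galois_map_cong:
  assumes "tensor_eq sA sH s t"
  shows "galois_map act s = galois_map act t"
  using assms unfolding tensor_eq_def
proof (induction rule: sum_congruence.induct)
  case (gen s t)
  then show ?case
    by cases (auto simp: galois_map_def fun_eq_iff distrib_left distrib_right act_add act_scale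
        A.scale_mult_left A.scale_mult_right)
qed (auto simp: galois_map_def fun_eq_iff)


section \<open>Hom spaces, duals and the operators \<open>\<Phi>\<close>\<close>

text \<open>\<open>Hom\<^sub>H(W, A)\<close> for an \<open>H\<close>-module with carrier \<open>W\<close> and explicitly given operations. Only the
  restriction of a member to \<open>W\<close> matters; its values outside \<open>W\<close> are arbitrary.\<close>

definition hom_H ::
  "'w set \<Rightarrow> ('w \<Rightarrow> 'w \<Rightarrow> 'w) \<Rightarrow> ('k \<Rightarrow> 'w \<Rightarrow> 'w) \<Rightarrow> ('h \<Rightarrow> 'w \<Rightarrow> 'w) \<Rightarrow>
   ('k \<Rightarrow> 'a::ab_group_add \<Rightarrow> 'a) \<Rightarrow> ('h \<Rightarrow> 'a \<Rightarrow> 'a) \<Rightarrow> ('w \<Rightarrow> 'a) set" where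
  "hom_H W plusW sW actW sA act =
     {\<tau>. (\<forall>u\<in>W. \<forall>w\<in>W. \<tau> (plusW u w) = \<tau> u + \<tau> w)
       \<and> (\<forall>c. \<forall>w\<in>W. \<tau> (sW c w) = sA c (\<tau> w))
       \<and> (\<forall>h. \<forall>w\<in>W. \<tau> (actW h w) = act h (\<tau> w))}"

definition End_H ::
  "('k \<Rightarrow> 'a::ab_group_add \<Rightarrow> 'a) \<Rightarrow> ('h \<Rightarrow> 'a \<Rightarrow> 'a) \<Rightarrow> ('a \<Rightarrow> 'a) set" where
  "End_H sA act = hom_H UNIV (+) sA act sA act"

text \<open>Functionals on a subspace \<open>V\<close> are represented by functions vanishing outside \<open>V\<close>.\<close>

definition dual_space ::
  "('k::field \<Rightarrow> 'v::ab_group_add \<Rightarrow> 'v) \<Rightarrow> 'v set \<Rightarrow> ('v \<Rightarrow> 'k) set" where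
  "dual_space sV V =
     {\<xi>. (\<forall>v\<in>V. \<forall>w\<in>V. \<xi> (v + w) = \<xi> v + \<xi> w) \<and> (\<forall>c. \<forall>v\<in>V. \<xi> (sV c v) = c * \<xi> v)
       \<and> (\<forall>v. v \<notin> V \<longrightarrow> \<xi> v = 0)}"

definition dual_action ::
  "('h \<Rightarrow> 'h) \<Rightarrow> ('h \<Rightarrow> 'v \<Rightarrow> 'v) \<Rightarrow> 'v set \<Rightarrow> 'h \<Rightarrow> ('v \<Rightarrow> 'k::field) \<Rightarrow> 'v \<Rightarrow> 'k" where
  "dual_action S act V h \<xi> = (\<lambda>v. if v \<in> V then \<xi> (act (S h) v) else 0)"

definition D_dual ::
  "('h \<Rightarrow> 'h) \<Rightarrow> ('k::field \<Rightarrow> 'v::ab_group_add \<Rightarrow> 'v) \<Rightarrow> ('h \<Rightarrow> 'v \<Rightarrow> 'v) \<Rightarrow> 'v set \<Rightarrow>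
   ('k \<Rightarrow> 'a::ab_group_add \<Rightarrow> 'a) \<Rightarrow> ('h \<Rightarrow> 'a \<Rightarrow> 'a) \<Rightarrow> (('v \<Rightarrow> 'k) \<Rightarrow> 'a) set" where
  "D_dual S sV actV V sA act =
     hom_H (dual_space sV V) (\<lambda>\<xi> \<eta> v. \<xi> v + \<eta> v) (\<lambda>c \<xi> v. c * \<xi> v) (dual_action S actV V) sA act"

text \<open>For a basis \<open>B\<close> of \<open>V\<close>, the dual basis vector of \<open>e \<in> B\<close> is the coordinate functional; it
  vanishes outside \<open>V\<close> because \<open>representation\<close> is zero off the span of the basis.\<close>

definition dual_basis_vector ::
  "('k::field \<Rightarrow> 'v::ab_group_add \<Rightarrow> 'v) \<Rightarrow> 'v set \<Rightarrow> 'v \<Rightarrow> 'v \<Rightarrow> 'k" where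
  "dual_basis_vector sV B e = (\<lambda>v. module.representation sV B v e)"

definition Phi ::
  "('k::field \<Rightarrow> 'v::ab_group_add \<Rightarrow> 'v) \<Rightarrow> 'v set \<Rightarrow> (('v \<Rightarrow> 'k) \<Rightarrow> 'a) \<Rightarrow> ('v \<Rightarrow> 'a) \<Rightarrow>
   'a::ring_1 \<Rightarrow> 'a" where
  "Phi sV B \<tau> \<sigma> = (\<lambda>a. \<Sum>e\<in>B. \<tau> (dual_basis_vector sV B e) * a * \<sigma> e)"

end

theory Submission
  imports Defs "HOL-Algebra.Free_Abelian_Groups"
begin

text \<open>Put \<open>E = End\<^sub>H A\<close>, let \<open>R\<close> be the algebra generated by the operators \<open>\<Phi>\<close>, and let
  \<open>A R\<close> be the left \<open>A\<close>-module of operators spanned by \<open>R\<close>, that is, the set of all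
  \<open>x \<mapsto> \<Sum> a\<^sub>i r\<^sub>i(x)\<close> with \<open>r\<^sub>i \<in> R\<close>. Cocommutativity gives \<open>R \<subseteq> E\<close> (\<open>Phi_in_End_H\<close>).
  The converse comes from comparing \<open>R\<close> and \<open>E\<close> after extension to left \<open>A\<close>-modules: first
  \<open>A R\<close> is all of \<open>End A\<close>, and then \<open>E \<inter> A R = R\<close>.

  For \<open>A R = End A\<close> the point is that right multiplication by \<open>v \<in> V\<close> lies in the left
  \<open>A\<close>-span of the \<open>\<Phi>\<close> (\<open>right_mult_eq_Phi_combination\<close>). A functional \<open>\<phi> : A \<rightarrow> k \<subseteq> A\<close> is
  \<open>\<pi>(\<Sum> a\<^sub>j \<otimes> h\<^sub>j)\<close> for a unique tensor, which satisfies the invariance \<open>g \<phi> = \<epsilon>(g) \<phi>\<close> in the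
  smash product \<open>A # H\<close>; this makes \<open>\<xi> \<mapsto> \<Sum> \<langle>\<xi>, h\<^sub>j v\<rangle> a\<^sub>j\<close> an \<open>H\<close>-linear map
  \<open>V\<^sup>* \<rightarrow> A\<close>, whose operator \<open>\<Phi>\<close> is \<open>y \<mapsto> \<Sum> a\<^sub>j y (h\<^sub>j v)\<close>. Since \<open>A\<close> is finite
  dimensional (\<open>finite_basis\<close>), the identity is \<open>\<Sum> x \<phi>\<^sub>x\<close> over a basis of \<open>A\<close> with its
  coordinate functionals. By injectivity of \<open>\<pi>\<close> the tensors of the \<open>x \<phi>\<^sub>x\<close> add up to \<open>1 \<otimes> 1\<close>, so
  the operators \<open>x \<Phi>\<^sub>x\<close> add up to \<open>y \<mapsto> y v\<close>. Left multiplications commute with right ones, so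
  \<open>A R\<close> is stable under right multiplication by \<open>V\<close>, hence by the algebra \<open>A\<close> that \<open>V\<close>
  generates. As \<open>A\<close> is central simple, the Jacobson density argument applied to the
  \<open>A\<close>-bimodule \<open>A\<close> yields \<open>A R = End A\<close> (\<open>linear_in_bimodule_operators\<close>).

  For \<open>E \<inter> A R = R\<close> let \<open>e = \<Sum> a\<^sub>i r\<^sub>i\<close> with \<open>e, r\<^sub>i \<in> E\<close>. The action of \<open>H\<close>, and hence of
  \<open>A # H = End A\<close>, can be applied to the coefficients \<open>1\<close> and \<open>a\<^sub>i\<close> of this relation
  (\<open>descend_coefficients\<close>). Applying a functional with \<open>f(1) = 1\<close> gives
  \<open>e = \<Sum> f(a\<^sub>i) r\<^sub>i \<in> R\<close>.\<close>

section \<open>Sweedler sums\<close>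

lemma additive_sum_mset:
  fixes f :: "'b::ab_group_add \<Rightarrow> 'c::ab_group_add"
  assumes "\<And>x y. f (x + y) = f x + f y"
  shows "f (\<Sum>x\<in>#M. g x) = (\<Sum>x\<in>#M. f (g x))"
proof (induction M)
  case empty
  have "f 0 = 0"
    using assms[of 0 0] by simp
  then show ?case by simp
qed (simp add: assms)

lemma sum_image_mset_sum_mset:
  "(\<Sum>z\<in>#(\<Sum>x\<in>#M. N x). f z) = (\<Sum>x\<in>#M. \<Sum>z\<in>#N x. f z)"
  by (induction M) auto

text \<open>A balanced biadditive map factors through the tensor product. Being balanced means that scalars
  move between the arguments, which makes sense for any abelian group as target.\<close>

lemma tensor_eq_sum_mset:
  fixes G :: "'v::ab_group_add \<Rightarrow> 'w::ab_group_add \<Rightarrow> 'c::ab_group_add"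
  assumes "tensor_eq sV sW s t"
    and "\<And>x x' y. G (x + x') y = G x y + G x' y"
    and "\<And>x y y'. G x (y + y') = G x y + G x y'"
    and "\<And>c x y. G (sV c x) y = G x (sW c y)"
  shows "(\<Sum>(x, y)\<in>#s. G x y) = (\<Sum>(x, y)\<in>#t. G x y)"
  using assms(1) unfolding tensor_eq_def
proof (induction rule: sum_congruence.induct)
  case (gen s t)
  have "G 0 y = 0" for y
    using assms(2)[of 0 0 y] by simp
  with gen show ?case
    by cases (auto simp: assms)
qed auto

lemma tensor3_eq_sum_mset:
  fixes F :: "'v::ab_group_add \<Rightarrow> 'v \<Rightarrow> 'v \<Rightarrow> 'c::ab_group_add"
  assumes "tensor3_eq sV s t"
    and "\<And>x x' y z. F (x + x') y z = F x y z + F x' y z"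
    and "\<And>x y y' z. F x (y + y') z = F x y z + F x y' z"
    and "\<And>x y z z'. F x y (z + z') = F x y z + F x y z'"
    and "\<And>c x y z. F (sV c x) y z = F x (sV c y) z"
    and "\<And>c x y z. F x (sV c y) z = F x y (sV c z)"
  shows "(\<Sum>(x, y, z)\<in>#s. F x y z) = (\<Sum>(x, y, z)\<in>#t. F x y z)"
  using assms(1) unfolding tensor3_eq_def
proof (induction rule: sum_congruence.induct)
  case (gen s t)
  have "F 0 y z = 0" for y z
    using assms(2)[of 0 0 y z] by simp
  with gen show ?case
    by cases (use assms(2-6) in \<open>auto\<close>)
qed auto

context hopf_algebra
begin

lemma comult_coassoc:
  fixes F :: "'h \<Rightarrow> 'h \<Rightarrow> 'h \<Rightarrow> 'c::ab_group_add"
  assumes "\<And>x x' y z. F (x + x') y z = F x y z + F x' y z"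
    and "\<And>x y y' z. F x (y + y') z = F x y z + F x y' z"
    and "\<And>x y z z'. F x y (z + z') = F x y z + F x y z'"
    and "\<And>c x y z. F (c *s x) y z = F x (c *s y) z"
    and "\<And>c x y z. F x (c *s y) z = F x y (c *s z)"
  shows "(\<Sum>(x, y)\<in>#\<Delta> h. \<Sum>(x', x'')\<in>#\<Delta> x. F x' x'' y) =
    (\<Sum>(x, y)\<in>#\<Delta> h. \<Sum>(y', y'')\<in>#\<Delta> y. F x y' y'')"
  using tensor3_eq_sum_mset[OF coassoc, of F h] assms
  by (simp add: sum_image_mset_sum_mset case_prod_unfold image_mset.compositionality comp_def)

lemma comult_commute:
  fixes G :: "'h \<Rightarrow> 'h \<Rightarrow> 'c::ab_group_add"
  assumes "cocommutative scale \<Delta>"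
    and "\<And>x x' y. G (x + x') y = G x y + G x' y"
    and "\<And>x y y'. G x (y + y') = G x y + G x y'"
    and "\<And>c x y. G (c *s x) y = G x (c *s y)"
  shows "(\<Sum>(x, y)\<in>#\<Delta> h. G x y) = (\<Sum>(x, y)\<in>#\<Delta> h. G y x)"
  using tensor_eq_sum_mset[of scale scale "\<Delta> h" "image_mset prod.swap (\<Delta> h)" G] assms
  by (simp add: cocommutative_def case_prod_unfold image_mset.compositionality comp_def)

lemma antipode_add: "S (x + y) = S x + S y"
  and antipode_scale: "S (c *s x) = c *s S x"
proof -
  interpret S: Vector_Spaces.linear scale scale S
    by (rule antipode_linear)
  show "S (x + y) = S x + S y" "S (c *s x) = c *s S x"
    by (simp_all add: S.add S.scale)
qed

text \<open>These are the antipode axioms of the co-opposite Hopf algebra, which a cocommutative \<open>H\<close>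
  equals.\<close>

lemma antipode_left_swapped:
  assumes "cocommutative scale \<Delta>"
  shows "(\<Sum>(x, y)\<in>#\<Delta> h. S y * x) = \<epsilon> h *s 1"
  by (subst antipode_left[symmetric], rule comult_commute[OF assms])
    (simp_all add: antipode_add antipode_scale algebra_simps scale_mult_left scale_mult_right)

lemma antipode_right_swapped:
  assumes "cocommutative scale \<Delta>"
  shows "(\<Sum>(x, y)\<in>#\<Delta> h. y * S x) = \<epsilon> h *s 1"
  by (subst antipode_right[symmetric], rule comult_commute[OF assms])
    (simp_all add: antipode_add antipode_scale algebra_simps scale_mult_left scale_mult_right)

end

context module_algebra
begin

lemma act_plus: "act h (a + b) = act h a + act h b"
  and act_scale_right: "act h (sA c a) = sA c (act h a)"
proof -
  interpret L: Vector_Spaces.linear sA sA "act h"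
    by (rule act_linear)
  show "act h (a + b) = act h a + act h b" "act h (sA c a) = sA c (act h a)"
    by (simp_all add: L.add L.scale)
qed

lemma act_sum_left: "act (\<Sum>x\<in>#M. g x) a = (\<Sum>x\<in>#M. act (g x) a)"
  by (rule additive_sum_mset) (rule act_add)

lemma act_sum_right: "act h (\<Sum>x\<in>#M. g x) = (\<Sum>x\<in>#M. act h (g x))"
  by (rule additive_sum_mset) (rule act_plus)

text \<open>The product \<open>(h a) y\<close> is what remains of \<open>\<Sum> (h\<^sub>1 a) (h\<^sub>2 S(h\<^sub>3) y)\<close>. The right-hand side
  below involves \<open>y\<close> only through \<open>a (S(q) y)\<close>, so a relation between products can be acted on in
  its left factors alone.\<close>

lemma act_mult_shift:
  "act h a * y = (\<Sum>(p, q)\<in>#\<Delta> h. act p (a * act (S q) y))"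
proof -
  have "(\<Sum>(p, q)\<in>#\<Delta> h. act p (a * act (S q) y))
      = (\<Sum>(p, q)\<in>#\<Delta> h. \<Sum>(p', p'')\<in>#\<Delta> p. act p' a * act (p'' * S q) y)"
    by (simp add: act_on_mult act_mult)
  also have "\<dots> = (\<Sum>(p, q)\<in>#\<Delta> h. \<Sum>(q', q'')\<in>#\<Delta> q. act p a * act (q' * S q'') y)"
    by (rule H.comult_coassoc)
      (simp_all add: act_add act_scale act_mult act_plus act_scale_right H.antipode_add
        H.antipode_scale algebra_simps A.scale_mult_left A.scale_mult_right)
  also have "\<dots> = (\<Sum>(p, q)\<in>#\<Delta> h. act p a * act (\<Sum>(q', q'')\<in>#\<Delta> q. q' * S q'') y)"
    by (simp add: act_sum_left sum_mset_distrib_left case_prod_unfold)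
  also have "\<dots> = (\<Sum>(p, q)\<in>#\<Delta> h. act (sH (\<epsilon> q) p) a * y)"
    by (simp add: H.antipode_right act_scale act_one A.scale_mult_left A.scale_mult_right)
  also have "\<dots> = act (\<Sum>(p, q)\<in>#\<Delta> h. sH (\<epsilon> q) p) a * y"
    by (simp add: act_sum_left sum_mset_distrib_right case_prod_unfold)
  finally show ?thesis
    by (simp add: H.counit_right)
qed

lemma End_H_closed:
  "id \<in> End_H sA act"
  "r \<in> End_H sA act \<Longrightarrow> q \<in> End_H sA act \<Longrightarrow> (\<lambda>x. r x + q x) \<in> End_H sA act"
  "r \<in> End_H sA act \<Longrightarrow> q \<in> End_H sA act \<Longrightarrow> r \<circ> q \<in> End_H sA act"
  "r \<in> End_H sA act \<Longrightarrow> (\<lambda>x. sA c (r x)) \<in> End_H sA act"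
  by (simp_all add: End_H_def hom_H_def act_plus act_scale_right algebra_simps
      A.scale_right_distrib A.scale_left_commute)

end

section \<open>Density for central simple algebras\<close>

context k_algebra
begin

text \<open>Jacobson density for \<open>A\<close> as a simple bimodule over itself, whose bimodule endomorphisms are
  the centre \<open>k\<close>. The induction is on the number of vectors. The values at \<open>x\<close> of operators that
  vanish on \<open>Y = X - {x}\<close> form a two-sided ideal. If it is zero, correcting any \<open>w\<close> by the operators
  \<open>u y\<close> dual to \<open>Y\<close> shows that \<open>w x = \<Sum> w(y) z\<^sub>y\<close> with \<open>z\<^sub>y = u y x\<close>. Taking for \<open>w\<close> the
  operator \<open>u y\<close> followed by a right multiplication makes \<open>z\<^sub>y\<close> central, hence scalar, and taking
  \<open>w = id\<close> then puts \<open>x\<close> into the span of \<open>Y\<close>.\<close>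

lemma central_simple_density:
  assumes "central_algebra scale" and "simple_algebra scale"
    and T_id: "(\<lambda>x. x) \<in> T"
    and T_add: "\<And>u w. u \<in> T \<Longrightarrow> w \<in> T \<Longrightarrow> (\<lambda>x. u x + w x) \<in> T"
    and T_left: "\<And>u b. u \<in> T \<Longrightarrow> (\<lambda>x. b * u x) \<in> T"
    and T_right: "\<And>u b. u \<in> T \<Longrightarrow> (\<lambda>x. u x * b) \<in> T"
  shows "finite X \<Longrightarrow> independent X \<Longrightarrow> x \<in> X \<Longrightarrow> \<exists>u\<in>T. u x = 1 \<and> (\<forall>y\<in>X - {x}. u y = 0)"
proof (induction "card X" arbitrary: X x rule: less_induct)
  case less
  define Y where "Y = X - {x}"
  have Y: "finite Y" "card Y < card X" "x \<notin> span Y"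
    using less.prems unfolding Y_def
    by (auto intro: card_Diff1_less simp: dependent_def simp del: card_Diff_insert)
  have indep: "independent Y"
    using less.prems unfolding Y_def by (meson Diff_subset independent_mono)
  have "\<exists>u\<in>T. u y = 1 \<and> (\<forall>z\<in>Y - {y}. u z = 0)" if "y \<in> Y" for y
    using less.hyps[OF Y(2) Y(1) indep that] .
  then obtain u where u: "\<And>y. y \<in> Y \<Longrightarrow> u y \<in> T" "\<And>y. y \<in> Y \<Longrightarrow> u y y = 1"
    "\<And>y z. y \<in> Y \<Longrightarrow> z \<in> Y \<Longrightarrow> z \<noteq> y \<Longrightarrow> u y z = 0"
    by (metis Diff_iff empty_iff insert_iff)
  have T_zero: "(\<lambda>x. 0) \<in> T"
    using T_left[OF T_id, of 0] by simp
  have T_sum: "(\<lambda>a. \<Sum>y\<in>Z. w y a) \<in> T" if "finite Z" "\<And>y. y \<in> Z \<Longrightarrow> w y \<in> T" for Z and w :: "'a \<Rightarrow> 'a \<Rightarrow> 'a"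
    using that by (induction Z) (auto simp: T_zero intro!: T_add)
  define I where "I = {w x |w. w \<in> T \<and> (\<forall>y\<in>Y. w y = 0)}"
  have I_I: "w x \<in> I" if "w \<in> T" "\<forall>y\<in>Y. w y = 0" for w
    using that unfolding I_def by blast
  have "two_sided_ideal I"
    unfolding two_sided_ideal_def
  proof (intro conjI ballI allI)
    show "0 \<in> I"
      unfolding I_def using T_zero by auto
  next
    fix a b assume "a \<in> I" "b \<in> I"
    then obtain w w' where "w \<in> T" "w' \<in> T" "\<forall>y\<in>Y. w y = 0" "\<forall>y\<in>Y. w' y = 0" "a = w x" "b = w' x"
      unfolding I_def by auto
    with T_add[of w w'] show "a + b \<in> I"
      unfolding I_def by (auto intro!: exI[of _ "\<lambda>x. w x + w' x"])
  next
    fix a b assume "a \<in> I"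
    then obtain w where "w \<in> T" "\<forall>y\<in>Y. w y = 0" "a = w x"
      unfolding I_def by auto
    with I_I[OF T_left[of w b]] I_I[OF T_right[of w b]] show "b * a \<in> I" "a * b \<in> I"
      by simp_all
  qed
  then consider "I = {0}" | "I = UNIV"
    using assms(2) unfolding simple_algebra_def by blast
  then show ?case
  proof cases
    case 2
    then have "1 \<in> I" by simp
    then show ?thesis
      unfolding I_def Y_def by auto
  next
    case 1
    \<comment> \<open>The operator \<open>w' = w - \<Sum> w(y) u y\<close> vanishes on \<open>Y\<close>, so its value at \<open>x\<close> lies in \<open>I\<close>.\<close>
    have rel: "w x = (\<Sum>y\<in>Y. w y * u y x)" if w: "w \<in> T" for w
    proof -
      define w' where "w' = (\<lambda>a. w a + (- 1) * (\<Sum>y\<in>Y. w y * u y a))"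
      have "w' \<in> T"
        unfolding w'_def by (intro T_add w T_left T_sum Y u)
      moreover have "w' z = 0" if z: "z \<in> Y" for z
      proof -
        have "(\<Sum>y\<in>Y. w y * u y z) = (\<Sum>y\<in>Y. if y = z then w y else 0)"
          using z by (intro sum.cong) (auto simp: u)
        then show ?thesis
          using z Y by (simp add: w'_def)
      qed
      ultimately have "w' x \<in> I"
        unfolding I_def by auto
      then show ?thesis
        using 1 by (simp add: w'_def)
    qed
    have "\<exists>c. u z x = scale c 1" if z: "z \<in> Y" for z
    proof -
      have "u z x * b = b * u z x" for b
      proof -
        have "u z x * b = (\<Sum>y\<in>Y. u z y * b * u y x)"
          using rel[OF T_right[OF u(1)[OF z]]] by simp
        also have "\<dots> = (\<Sum>y\<in>Y. if y = z then b * u y x else 0)"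
          using z by (intro sum.cong) (auto simp: u)
        also have "\<dots> = b * u z x"
          using z Y by simp
        finally show ?thesis .
      qed
      then show ?thesis
        using assms(1) unfolding central_algebra_def by blast
    qed
    then obtain c where c: "\<And>z. z \<in> Y \<Longrightarrow> u z x = scale (c z) 1"
      by metis
    have "x = (\<Sum>y\<in>Y. scale (c y) y)"
      using rel[OF T_id] by (simp add: c scale_mult_right)
    also have "\<dots> \<in> span Y"
      by (intro span_sum span_scale span_base)
    finally show ?thesis
      using Y by simp
  qed
qed

text \<open>With operators \<open>u x\<close> dual to a basis \<open>X\<close>, a linear map is \<open>f = \<Sum> f(x) u x\<close>.\<close>

lemma linear_in_bimodule_operators:
  assumes csa: "central_algebra scale" "simple_algebra scale"
    and X: "finite X" "independent X" "span X = UNIV"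
    and T_id: "(\<lambda>x. x) \<in> T"
    and T_add: "\<And>u w. u \<in> T \<Longrightarrow> w \<in> T \<Longrightarrow> (\<lambda>x. u x + w x) \<in> T"
    and T_left: "\<And>u b. u \<in> T \<Longrightarrow> (\<lambda>x. b * u x) \<in> T"
    and T_right: "\<And>u b. u \<in> T \<Longrightarrow> (\<lambda>x. u x * b) \<in> T"
    and T_linear: "\<And>u. u \<in> T \<Longrightarrow> Vector_Spaces.linear scale scale u"
    and f: "Vector_Spaces.linear scale scale f"
  shows "f \<in> T"
proof -
  interpret P: vector_space_pair scale scale ..
  have "\<exists>u\<in>T. u x = 1 \<and> (\<forall>y\<in>X - {x}. u y = 0)" if "x \<in> X" for x
    using central_simple_density[OF csa T_id T_add T_left T_right X(1,2) that] .
  then obtain u where u: "\<And>x. x \<in> X \<Longrightarrow> u x \<in> T" "\<And>x. x \<in> X \<Longrightarrow> u x x = 1"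
    "\<And>x y. x \<in> X \<Longrightarrow> y \<in> X \<Longrightarrow> y \<noteq> x \<Longrightarrow> u x y = 0"
    by (metis Diff_iff empty_iff insert_iff)
  define w where "w = (\<lambda>a. \<Sum>x\<in>X. f x * u x a)"
  have T_zero: "(\<lambda>x. 0) \<in> T"
    using T_left[OF T_id, of 0] by simp
  have "(\<lambda>a. \<Sum>x\<in>Z. f x * u x a) \<in> T" if "finite Z" "Z \<subseteq> X" for Z
    using that by (induction Z) (auto simp: T_zero intro!: T_add T_left u)
  then have w: "w \<in> T"
    unfolding w_def using X(1) by blast
  have "f y = w y" if "y \<in> X" for y
  proof -
    have "w y = (\<Sum>x\<in>X. if x = y then f x else 0)"
      unfolding w_def using that by (intro sum.cong) (auto simp: u)
    then show ?thesis
      using that X(1) by simp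
  qed
  then have "f y = w y" for y
    using P.linear_eq_on[OF f T_linear[OF w], of y X] X(3) by simp
  then have "f = w" ..
  with w show ?thesis by simp
qed

end

section \<open>Consequences of the Galois property\<close>

locale galois_module_algebra = module_algebra sH \<Delta> \<epsilon> S sA act
  for sH :: "'k::field \<Rightarrow> 'h::ring_1 \<Rightarrow> 'h"
    and \<Delta> :: "'h \<Rightarrow> ('h \<times> 'h) multiset"
    and \<epsilon> :: "'h \<Rightarrow> 'k"
    and S :: "'h \<Rightarrow> 'h"
    and sA :: "'k \<Rightarrow> 'a::ring_1 \<Rightarrow> 'a"
    and act :: "'h \<Rightarrow> 'a \<Rightarrow> 'a" +
  assumes fin_dim_H: "finite_dimensional sH"
    and galois: "dual_galois sH sA act"
begin

sublocale AA: vector_space_pair sA sA ..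

lemma the_elem_galois_map_class:
  "the_elem (galois_map act ` ({(s, t). tensor_eq sA sH s t} `` {t})) = galois_map act t"
proof -
  have "tensor_eq sA sH t t"
    unfolding tensor_eq_def by (rule sum_congruence.refl)
  then have "t \<in> {(s, t). tensor_eq sA sH s t} `` {t}"
    by blast
  moreover have "galois_map act s = galois_map act t" if "s \<in> {(s, t). tensor_eq sA sH s t} `` {t}" for s
    using galois_map_cong[of t s] that by simp
  ultimately show ?thesis
    by (intro the_elem_image_unique) blast+
qed

lemma galois_map_surj:
  assumes "Vector_Spaces.linear sA sA f"
  obtains t where "galois_map act t = f"
proof -
  have "f \<in> (\<lambda>X. the_elem (galois_map act ` X)) ` tensor_product sA sH"
    using galois assms unfolding dual_galois_def bij_betw_def by auto
  then obtain t where "f = the_elem (galois_map act ` ({(s, t). tensor_eq sA sH s t} `` {t}))"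
    unfolding tensor_product_def quotient_def by auto
  then show ?thesis
    using that the_elem_galois_map_class by simp
qed

lemma galois_map_inj:
  assumes "galois_map act s = galois_map act t"
  shows "tensor_eq sA sH s t"
proof -
  let ?R = "{(s, t). tensor_eq sA sH s t}"
  have "?R `` {s} \<in> tensor_product sA sH" "?R `` {t} \<in> tensor_product sA sH"
    unfolding tensor_product_def by (rule quotientI, rule UNIV_I)+
  then have "?R `` {s} = ?R `` {t}"
    using galois assms the_elem_galois_map_class
    unfolding dual_galois_def bij_betw_def inj_on_def by metis
  moreover have "t \<in> ?R `` {t}"
    by (simp add: tensor_eq_def sum_congruence.refl)
  ultimately show ?thesis
    by auto
qed

lemma mult_act_in_span:
  assumes "a \<in> A.span F" and "h \<in> H.span Y"
  shows "a * act h w \<in> A.span {y * act g w |y g. y \<in> F \<and> g \<in> Y}" (is "_ \<in> A.span ?U")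
  using assms(1)
proof (induction rule: A.span_induct_alt)
  case (step c x y)
  have "x * act h w \<in> A.span ?U"
    using assms(2)
  proof (induction rule: H.span_induct_alt)
    case base
    have "act 0 w = 0"
      using act_add[of 0 0 w] by simp
    then show ?case
      by (simp add: A.span_zero)
  next
    case (step d g g')
    then have "x * act g w \<in> A.span ?U"
      using \<open>x \<in> F\<close> by (intro A.span_base) blast
    then have "sA d (x * act g w) + x * act g' w \<in> A.span ?U"
      using step by (intro A.span_add A.span_scale)
    then show ?case
      by (simp add: act_add act_scale distrib_left A.scale_mult_right)
  qed
  then have "sA c (x * act h w) + y * act h w \<in> A.span ?U"
    using step by (intro A.span_add A.span_scale)
  then show ?case
    by (simp add: distrib_right A.scale_mult_left)
qed (simp add: A.span_zero)

text \<open>Suppose that a basis \<open>X\<close> of \<open>A\<close> is infinite; then \<open>X\<close> has as many finite subsets \<open>F\<close> as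
  elements, say \<open>F \<mapsto> j F\<close>. An operator \<open>\<pi>(t)\<close> whose coefficients in \<open>A\<close> lie in the span of
  \<open>F\<close> sends \<open>j F\<close> into the finite dimensional space spanned by \<open>F \<cdot> (H (j F))\<close>. A linear map
  that leaves this space at \<open>j F\<close> for every \<open>F\<close> is not in the image of \<open>\<pi>\<close>.\<close>

lemma finite_basis:
  obtains X where "finite X" "A.independent X" "A.span X = UNIV"
proof -
  define X where "X = A.extend_basis {}"
  have X: "A.independent X" "A.span X = UNIV"
    unfolding X_def
    using A.independent_extend_basis[OF A.independent_empty]
      A.span_extend_basis[OF A.independent_empty] by blast+
  have "finite X"
  proof (rule ccontr)
    assume inf: "infinite X"
    obtain Y where Y: "finite Y" "H.span Y = UNIV"
      using fin_dim_H unfolding finite_dimensional_def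
      by (meson finite_dimensional_vector_space.finite_Basis
          finite_dimensional_vector_space.span_Basis)
    obtain j where j: "inj_on j (Fpow X)" "j ` Fpow X = X"
      using eqpoll_Fpow[OF inf] unfolding eqpoll_def bij_betw_def by blast
    define U where "U F = {y * act g (j F) |y g. y \<in> F \<and> g \<in> Y}" for F
    have "\<exists>z. z \<notin> A.span (U F)" if "F \<in> Fpow X" for F
    proof (rule ccontr)
      assume "\<nexists>z. z \<notin> A.span (U F)"
      then have "X \<subseteq> A.span (U F)" by auto
      moreover have "finite (U F)"
      proof -
        have "U F = (\<lambda>(y, g). y * act g (j F)) ` (F \<times> Y)"
          unfolding U_def by auto
        then show ?thesis
          using Y that by (simp add: Fpow_def)
      qed
      ultimately show False
        using A.independent_span_bound X inf by blast
    qed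
    then obtain z where z: "\<And>F. F \<in> Fpow X \<Longrightarrow> z F \<notin> A.span (U F)"
      by metis
    define f where "f = AA.construct X (\<lambda>x. z (inv_into (Fpow X) j x))"
    have f: "f (j F) = z F" if "F \<in> Fpow X" for F
    proof -
      have "j F \<in> X"
        using that j(2) by blast
      then show ?thesis
        using that j(1) X(1) by (simp add: f_def AA.construct_basis)
    qed
    have "Vector_Spaces.linear sA sA f"
      unfolding f_def using X(1) by (rule AA.linear_construct)
    then obtain t where t: "galois_map act t = f"
      by (rule galois_map_surj)
    define F where "F = (\<Union>(a, h)\<in>set_mset t. {b. A.representation X a b \<noteq> 0})"
    have F: "F \<in> Fpow X"
      unfolding F_def Fpow_def using A.representation_ne_zero A.finite_representation by fastforce
    have "a * act h (j F) \<in> A.span (U F)" if "(a, h) \<in># t" for a h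
      unfolding U_def
    proof (rule mult_act_in_span)
      have "a = (\<Sum>b | A.representation X a b \<noteq> 0. sA (A.representation X a b) b)"
        using A.sum_nonzero_representation_eq X by simp
      also have "\<dots> \<in> A.span F"
        using that unfolding F_def by (intro A.span_sum A.span_scale A.span_base) auto
      finally show "a \<in> A.span F" .
    qed (simp add: Y)
    moreover have "(\<Sum>x\<in>#m. g x) \<in> A.span W" if "\<And>x. x \<in># m \<Longrightarrow> g x \<in> A.span W"
      for m :: "('a \<times> 'h) multiset" and g W
      using that by (induction m) (auto intro: A.span_zero A.span_add)
    ultimately have "galois_map act t (j F) \<in> A.span (U F)"
      unfolding galois_map_def by (metis (no_types, lifting) case_prod_beta prod.collapse)
    then show False
      using z[OF F] f[OF F] t by simp
  qed
  with X that show ?thesis by blast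
qed

text \<open>The operator of a functional takes values in \<open>k\<close>, where \<open>H\<close> acts through \<open>\<epsilon>\<close>. By injectivity
  of \<open>\<pi>\<close> its tensor \<open>t\<close> is then invariant: \<open>\<Sum> g\<^sub>1 a \<otimes> g\<^sub>2 h = \<epsilon>(g) t\<close>, which is stated here
  after applying a balanced map.\<close>

lemma functional_coefficients:
  fixes G :: "'a \<Rightarrow> 'h \<Rightarrow> 'c::ab_group_add"
  assumes phi: "galois_map act t = (\<lambda>b. sA (f b) 1)"
    and G: "\<And>x x' y. G (x + x') y = G x y + G x' y"
      "\<And>x y y'. G x (y + y') = G x y + G x y'"
      "\<And>c x y. G (sA c x) y = G x (sH c y)"
  shows "(\<Sum>(p, q)\<in>#\<Delta> g. \<Sum>(a, h)\<in>#t. G (act p a) (q * h)) =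
    (\<Sum>(a, h)\<in>#t. G (sA (\<epsilon> g) a) h)"
proof -
  define s where "s = (\<Sum>(p, q)\<in>#\<Delta> g. image_mset (\<lambda>(a, h). (act p a, q * h)) t)"
  define s' where "s' = image_mset (\<lambda>(a, h). (sA (\<epsilon> g) a, h)) t"
  have "galois_map act s b = galois_map act s' b" for b
  proof -
    have "galois_map act s b = (\<Sum>(p, q)\<in>#\<Delta> g. \<Sum>(a, h)\<in>#t. act p a * act q (act h b))"
      by (simp add: s_def galois_map_def sum_image_mset_sum_mset case_prod_unfold
          image_mset.compositionality comp_def act_mult)
    also have "\<dots> = (\<Sum>(a, h)\<in>#t. \<Sum>(p, q)\<in>#\<Delta> g. act p a * act q (act h b))"
      unfolding case_prod_unfold by (rule sum_mset.swap)
    also have "\<dots> = act g (galois_map act t b)"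
      by (simp add: galois_map_def act_sum_right act_on_mult case_prod_unfold)
    also have "\<dots> = sA (\<epsilon> g) (galois_map act t b)"
      by (simp add: phi act_scale_right act_on_one A.scale_left_commute)
    also have "\<dots> = galois_map act s' b"
      unfolding s'_def galois_map_def
      by (subst additive_sum_mset[of "sA (\<epsilon> g)"])
        (simp_all add: A.scale_right_distrib case_prod_unfold image_mset.compositionality comp_def
          A.scale_mult_left)
    finally show ?thesis .
  qed
  then have "tensor_eq sA sH s s'"
    by (intro galois_map_inj ext)
  from tensor_eq_sum_mset[OF this, of G] G show ?thesis
    by (simp add: s_def s'_def sum_image_mset_sum_mset case_prod_unfold
        image_mset.compositionality comp_def)
qed

text \<open>With \<open>L h = \<langle>\<xi>, h v\<rangle>\<close> this is the \<open>H\<close>-linearity of the map \<open>V\<^sup>* \<rightarrow> A\<close> built from a functional.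
  Inserting \<open>g = \<Sum> \<epsilon>(g\<^sub>1) g\<^sub>2\<close> on the left and using the invariance of \<open>t\<close> under
  \<open>g\<^sub>1\<close> gives \<open>\<Sum> L(S(g\<^sub>3) g\<^sub>2 h) (g\<^sub>1 a)\<close>. There \<open>S(g\<^sub>3) g\<^sub>2\<close> collapses because \<open>H\<close> is cocommutative.\<close>

lemma functional_equivariant:
  assumes cocomm: "cocommutative sH \<Delta>"
    and phi: "galois_map act t = (\<lambda>b. sA (f b) 1)"
    and L_add: "\<And>g h. L (g + h) = L g + L h"
    and L_scale: "\<And>c h. L (sH c h) = c * L h"
  shows "(\<Sum>(a, h)\<in>#t. sA (L (S g * h)) a) = act g (\<Sum>(a, h)\<in>#t. sA (L h) a)"
proof -
  let ?G = "\<lambda>u a h. sA (L (S u * h)) a"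
  note lin = L_add L_scale H.antipode_add H.antipode_scale algebra_simps H.scale_mult_left
    H.scale_mult_right A.scale_left_distrib A.scale_right_distrib act_add act_plus act_scale
    act_scale_right
  have L_sum: "L (\<Sum>x\<in>#M. k x) = (\<Sum>x\<in>#M. L (k x))" for M :: "('h \<times> 'h) multiset" and k
    by (rule additive_sum_mset) (rule L_add)
  have sA_sum: "sA (\<Sum>x\<in>#M. k x) a = (\<Sum>x\<in>#M. sA (k x) a)" for M :: "('h \<times> 'h) multiset" and k a
    by (rule additive_sum_mset) (rule A.scale_left_distrib)
  have "(\<Sum>(a, h)\<in>#t. ?G g a h) = (\<Sum>(a, h)\<in>#t. ?G (\<Sum>(p, q)\<in>#\<Delta> g. sH (\<epsilon> p) q) a h)"
    by (simp add: H.counit_left)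
  also have "\<dots> = (\<Sum>(p, q)\<in>#\<Delta> g. \<Sum>(a, h)\<in>#t. ?G (sH (\<epsilon> p) q) a h)"
    by (subst additive_sum_mset[of "\<lambda>u. \<Sum>(a, h)\<in>#t. ?G u a h"])
      (simp_all add: lin sum_mset.distrib case_prod_unfold)
  also have "\<dots> = (\<Sum>(p, q)\<in>#\<Delta> g. \<Sum>(a, h)\<in>#t. ?G q (sA (\<epsilon> p) a) h)"
    by (simp add: lin)
  also have "\<dots> = (\<Sum>(p, q)\<in>#\<Delta> g. \<Sum>(p', p'')\<in>#\<Delta> p. \<Sum>(a, h)\<in>#t. ?G q (act p' a) (p'' * h))"
    by (subst functional_coefficients[OF phi]) (simp_all add: lin)
  also have "\<dots> = (\<Sum>(p, q)\<in>#\<Delta> g. \<Sum>(q', q'')\<in>#\<Delta> q. \<Sum>(a, h)\<in>#t. ?G q'' (act p a) (q' * h))"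
    by (rule H.comult_coassoc) (simp_all add: lin sum_mset.distrib case_prod_unfold)
  also have "\<dots> = (\<Sum>(p, q)\<in>#\<Delta> g. \<Sum>(a, h)\<in>#t. \<Sum>(q', q'')\<in>#\<Delta> q. ?G q'' (act p a) (q' * h))"
    unfolding case_prod_unfold by (subst sum_mset.swap) simp
  also have "\<dots> = (\<Sum>(p, q)\<in>#\<Delta> g. \<Sum>(a, h)\<in>#t.
      sA (L ((\<Sum>(q', q'')\<in>#\<Delta> q. S q'' * q') * h)) (act p a))"
    by (simp add: sum_mset_distrib_right L_sum sA_sum case_prod_unfold mult.assoc)
  also have "\<dots> = (\<Sum>(p, q)\<in>#\<Delta> g. \<Sum>(a, h)\<in>#t. sA (L h) (act (sH (\<epsilon> q) p) a))"
    by (simp add: H.antipode_left_swapped[OF cocomm] lin)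
  also have "\<dots> = (\<Sum>(a, h)\<in>#t. sA (L h) (act (\<Sum>(p, q)\<in>#\<Delta> g. sH (\<epsilon> q) p) a))"
  proof -
    have "sA c (act (\<Sum>x\<in>#M. k x) a) = (\<Sum>x\<in>#M. sA c (act (k x) a))"
      for c a M and k :: "'h \<times> 'h \<Rightarrow> 'h"
      by (rule additive_sum_mset[of "\<lambda>u. sA c (act u a)"]) (simp add: lin)
    then show ?thesis
      unfolding case_prod_unfold by (subst sum_mset.swap) simp
  qed
  also have "\<dots> = act g (\<Sum>(a, h)\<in>#t. sA (L h) a)"
    using H.counit_right[of g]
    by (simp add: act_sum_right act_scale_right case_prod_unfold)
  finally show ?thesis .
qed

text \<open>By \<open>act_mult_shift\<close> and \<open>H\<close>-linearity, a relation \<open>1 e = \<Sum> a r\<close> implies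
  \<open>(h 1) e = \<Sum> (h a) r\<close>. Left \<open>A\<close>-combinations of such relations apply any operator \<open>\<pi>(t)\<close>
  to the coefficients, in particular a functional.\<close>

lemma descend_coefficients:
  assumes e: "e \<in> End_H sA act" and R: "\<And>a r. (a, r) \<in># m \<Longrightarrow> r \<in> End_H sA act"
    and eq: "\<And>x. e x = (\<Sum>(a, r)\<in>#m. a * r x)"
    and f: "Vector_Spaces.linear sA (*) f" "f 1 = 1"
  shows "e x = (\<Sum>(a, r)\<in>#m. sA (f a) (r x))"
proof -
  have "act h 1 * e x = (\<Sum>(a, r)\<in>#m. act h a * r x)" for h
  proof -
    have "act h 1 * e x = (\<Sum>(p, q)\<in>#\<Delta> h. act p (e (act (S q) x)))"
      using e by (subst act_mult_shift) (simp add: End_H_def hom_H_def)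
    also have "\<dots> = (\<Sum>(p, q)\<in>#\<Delta> h. \<Sum>(a, r)\<in>#m. act p (a * r (act (S q) x)))"
      by (simp add: eq act_sum_right case_prod_unfold)
    also have "\<dots> = (\<Sum>(a, r)\<in>#m. \<Sum>(p, q)\<in>#\<Delta> h. act p (a * r (act (S q) x)))"
      unfolding case_prod_unfold by (rule sum_mset.swap)
    also have "\<dots> = (\<Sum>(a, r)\<in>#m. act h a * r x)"
    proof (rule arg_cong[where f = sum_mset], rule image_mset_cong, clarify)
      fix a r assume "(a, r) \<in># m"
      from R[OF this] show "(\<Sum>(p, q)\<in>#\<Delta> h. act p (a * r (act (S q) x))) = act h a * r x"
        by (subst act_mult_shift) (simp add: End_H_def hom_H_def)
    qed
    finally show ?thesis .
  qed
  note step = this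
  interpret f: Vector_Spaces.linear sA "(*)" f by (rule f)
  have "Vector_Spaces.linear sA sA (\<lambda>b. sA (f b) 1)"
    by (simp add: Vector_Spaces.linear_iff A.vector_space_axioms f.add f.scale A.scale_left_distrib)
  then obtain t where t: "galois_map act t = (\<lambda>b. sA (f b) 1)"
    by (rule galois_map_surj)
  have "e x = galois_map act t 1 * e x"
    by (simp add: t f)
  also have "\<dots> = (\<Sum>(c, h)\<in>#t. c * (act h 1 * e x))"
    by (simp add: galois_map_def sum_mset_distrib_right case_prod_unfold mult.assoc)
  also have "\<dots> = (\<Sum>(c, h)\<in>#t. \<Sum>(a, r)\<in>#m. c * act h a * r x)"
    by (simp add: step sum_mset_distrib_left case_prod_unfold mult.assoc)
  also have "\<dots> = (\<Sum>(a, r)\<in>#m. \<Sum>(c, h)\<in>#t. c * act h a * r x)"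
    unfolding case_prod_unfold by (rule sum_mset.swap)
  also have "\<dots> = (\<Sum>(a, r)\<in>#m. galois_map act t a * r x)"
    by (simp add: galois_map_def sum_mset_distrib_right case_prod_unfold)
  also have "\<dots> = (\<Sum>(a, r)\<in>#m. sA (f a) (r x))"
    by (simp add: t A.scale_mult_left)
  finally show ?thesis .
qed

end

section \<open>The operators \<open>\<Phi>\<close>\<close>

lemma sum_sum_mset_swap:
  "(\<Sum>e\<in>B. \<Sum>x\<in>#M. g x e) = (\<Sum>x\<in>#M. \<Sum>e\<in>B. g x e)"
  by (induction M) (simp_all add: sum.distrib)

locale invariant_subspace = module_algebra sH \<Delta> \<epsilon> S sA act
  for sH :: "'k::field \<Rightarrow> 'h::ring_1 \<Rightarrow> 'h"
    and \<Delta> :: "'h \<Rightarrow> ('h \<times> 'h) multiset"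
    and \<epsilon> :: "'h \<Rightarrow> 'k"
    and S :: "'h \<Rightarrow> 'h"
    and sA :: "'k \<Rightarrow> 'a::ring_1 \<Rightarrow> 'a"
    and act :: "'h \<Rightarrow> 'a \<Rightarrow> 'a" +
  fixes V B :: "'a set"
  assumes cocomm: "cocommutative sH \<Delta>"
    and invariant: "\<And>h v. v \<in> V \<Longrightarrow> act h v \<in> V"
    and indep: "A.independent B" and span: "A.span B = V" and fin: "finite B"
begin

lemma sum_dual_basis: "v \<in> V \<Longrightarrow> (\<Sum>e\<in>B. sA (dual_basis_vector sA B e v) e) = v"
  unfolding dual_basis_vector_def using indep span fin
  by (intro A.sum_representation_eq) simp_all

lemma dual_basis_vector_in_dual: "dual_basis_vector sA B e \<in> dual_space sA V"
proof -
  have "A.representation B v e = 0" if "v \<notin> V" for v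
    using that span by (simp add: A.representation_def)
  then show ?thesis
    using indep span
    by (simp add: dual_space_def dual_basis_vector_def A.representation_add A.representation_scale)
qed

lemma dual_space_expand:
  assumes "\<xi> \<in> dual_space sA V"
  shows "\<xi> = (\<lambda>v. \<Sum>e\<in>B. \<xi> e * dual_basis_vector sA B e v)"
proof
  fix v
  have BV: "B \<subseteq> V"
    using span A.span_superset by blast
  show "\<xi> v = (\<Sum>e\<in>B. \<xi> e * dual_basis_vector sA B e v)"
  proof (cases "v \<in> V")
    case False
    then show ?thesis
      using assms dual_basis_vector_in_dual by (simp add: dual_space_def)
  next
    case True
    have V: "0 \<in> V" "\<And>x y. x \<in> V \<Longrightarrow> y \<in> V \<Longrightarrow> x + y \<in> V" "\<And>c x. x \<in> V \<Longrightarrow> sA c x \<in> V"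
      unfolding span[symmetric] by (auto intro: A.span_zero A.span_add A.span_scale)
    have "\<xi> 0 = 0"
      using assms V(1) unfolding dual_space_def by (force dest: bspec[where x = 0])
    have "(\<Sum>e\<in>C. sA (c e) e) \<in> V \<and> \<xi> (\<Sum>e\<in>C. sA (c e) e) = (\<Sum>e\<in>C. c e * \<xi> e)"
      if "finite C" "C \<subseteq> V" for C c
      using that
      by (induction C) (use assms V \<open>\<xi> 0 = 0\<close> in \<open>auto simp: dual_space_def\<close>)
    from this[OF fin BV, of "\<lambda>e. dual_basis_vector sA B e v"] show ?thesis
      using sum_dual_basis[OF True] by (simp add: mult.commute)
  qed
qed

lemma dual_action_in_dual:
  "\<xi> \<in> dual_space sA V \<Longrightarrow> dual_action S act V h \<xi> \<in> dual_space sA V"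
  using invariant A.span_add[of _ B] A.span_scale[of _ B]
  by (auto simp: dual_space_def dual_action_def act_plus act_scale_right span)

lemma D_dual_expand:
  assumes tau: "\<tau> \<in> D_dual S sA act V sA act" and xi: "\<xi> \<in> dual_space sA V"
  shows "\<tau> \<xi> = (\<Sum>e\<in>B. sA (\<xi> e) (\<tau> (dual_basis_vector sA B e)))"
proof -
  let ?D = "dual_space sA V"
  have add: "\<tau> (\<lambda>v. \<xi> v + \<eta> v) = \<tau> \<xi> + \<tau> \<eta>" if "\<xi> \<in> ?D" "\<eta> \<in> ?D" for \<xi> \<eta>
    using tau that unfolding D_dual_def hom_H_def by blast
  have scale: "\<tau> (\<lambda>v. c * \<xi> v) = sA c (\<tau> \<xi>)" if "\<xi> \<in> ?D" for c \<xi>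
    using tau that unfolding D_dual_def hom_H_def by blast
  have D: "(\<lambda>v. 0) \<in> ?D" "(\<lambda>v. c * \<xi> v) \<in> ?D" "(\<lambda>v. \<xi> v + \<eta> v) \<in> ?D"
    if "\<xi> \<in> ?D" "\<eta> \<in> ?D" for c \<xi> \<eta>
    using that by (auto simp: dual_space_def algebra_simps)
  have zero: "\<tau> (\<lambda>v. 0) = 0"
    using scale[OF xi, of 0] by simp
  have "(\<lambda>v. \<Sum>e\<in>C. c e * dual_basis_vector sA B e v) \<in> ?D \<and>
      \<tau> (\<lambda>v. \<Sum>e\<in>C. c e * dual_basis_vector sA B e v)
        = (\<Sum>e\<in>C. sA (c e) (\<tau> (dual_basis_vector sA B e)))" if "finite C" for C c
    using that
  proof (induction C)
    case empty
    then show ?case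
      using D(1)[OF xi xi] zero by simp
  next
    case (insert e C)
    have "(\<lambda>v. c e * dual_basis_vector sA B e v) \<in> ?D"
      by (rule D(2)) (rule dual_basis_vector_in_dual)+
    with insert show ?case
      using D(3) dual_basis_vector_in_dual by (simp add: add scale)
  qed
  from this[OF fin, of \<xi>] show ?thesis
    using dual_space_expand[OF xi] by simp
qed

text \<open>Invariance of the canonical element \<open>\<Sum> e\<^sub>i\<^sup>* \<otimes> e\<^sub>i\<close>: moving \<open>g\<close> from \<open>e\<^sub>i\<^sup>*\<close> to \<open>e\<^sub>i\<close> turns it
  into \<open>S(g)\<close>.\<close>

lemma Phi_shift:
  assumes tau: "\<tau> \<in> D_dual S sA act V sA act"
  shows "(\<Sum>e\<in>B. act g (\<tau> (dual_basis_vector sA B e)) * y * act k e) =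
    (\<Sum>e\<in>B. \<tau> (dual_basis_vector sA B e) * y * act (k * S g) e)"
proof -
  let ?e = "dual_basis_vector sA B"
  have BV: "B \<subseteq> V"
    using span A.span_superset by blast
  have sum: "act k (\<Sum>e\<in>B. c e) = (\<Sum>e\<in>B. act k (c e))" for c
    by (simp add: sum_unfold_sum_mset act_sum_right)
  have "act g (\<tau> (?e e)) = (\<Sum>l\<in>B. sA (?e e (act (S g) l)) (\<tau> (?e l)))" for e
  proof -
    have "act g (\<tau> (?e e)) = \<tau> (dual_action S act V g (?e e))"
      using tau dual_basis_vector_in_dual unfolding D_dual_def hom_H_def by simp
    also have "\<dots> = (\<Sum>l\<in>B. sA (dual_action S act V g (?e e) l) (\<tau> (?e l)))"
      by (rule D_dual_expand[OF tau dual_action_in_dual[OF dual_basis_vector_in_dual]])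
    also have "\<dots> = (\<Sum>l\<in>B. sA (?e e (act (S g) l)) (\<tau> (?e l)))"
      using BV by (intro sum.cong) (auto simp: dual_action_def)
    finally show ?thesis .
  qed
  then have "(\<Sum>e\<in>B. act g (\<tau> (?e e)) * y * act k e)
      = (\<Sum>e\<in>B. \<Sum>l\<in>B. \<tau> (?e l) * y * act k (sA (?e e (act (S g) l)) e))"
    by (simp add: sum_distrib_right A.scale_mult_left A.scale_mult_right act_scale_right)
  also have "\<dots> = (\<Sum>l\<in>B. \<Sum>e\<in>B. \<tau> (?e l) * y * act k (sA (?e e (act (S g) l)) e))"
    by (rule sum.swap)
  also have "\<dots> = (\<Sum>l\<in>B. \<tau> (?e l) * y * act k (\<Sum>e\<in>B. sA (?e e (act (S g) l)) e))"
    by (simp add: sum_distrib_left sum)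
  also have "\<dots> = (\<Sum>l\<in>B. \<tau> (?e l) * y * act k (act (S g) l))"
  proof (rule sum.cong[OF HOL.refl])
    fix l assume "l \<in> B"
    then have "act (S g) l \<in> V"
      using BV invariant by blast
    from sum_dual_basis[OF this]
    show "\<tau> (?e l) * y * act k (\<Sum>e\<in>B. sA (?e e (act (S g) l)) e) =
        \<tau> (?e l) * y * act k (act (S g) l)"
      by simp
  qed
  finally show ?thesis
    by (simp add: act_mult)
qed

text \<open>Applying \<open>h\<close> to \<open>\<tau>(e\<^sub>i\<^sup>*) y e\<^sub>i\<close> and shifting gives \<open>\<tau>(e\<^sub>i\<^sup>*) (h\<^sub>2 y) (h\<^sub>3 S(h\<^sub>1) e\<^sub>i)\<close>.
  The factors \<open>h\<^sub>1\<close> and \<open>h\<^sub>3\<close> are not adjacent; cocommutativity brings them together, and they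
  cancel.\<close>

lemma Phi_in_End_H:
  assumes tau: "\<tau> \<in> D_dual S sA act V sA act"
  shows "Phi sA B \<tau> (\<lambda>v. v) \<in> End_H sA act"
proof -
  let ?P = "Phi sA B \<tau> (\<lambda>v. v)"
  let ?t = "\<lambda>e. \<tau> (dual_basis_vector sA B e)"
  have "?P (act h y) = act h (?P y)" for h y
  proof -
    note lin = act_add act_plus act_scale act_scale_right algebra_simps A.scale_mult_left
      A.scale_mult_right H.scale_mult_left H.scale_mult_right H.antipode_add H.antipode_scale
      sum.distrib
    have "act h (?P y) = (\<Sum>e\<in>B. act h (?t e * y * e))"
      by (simp add: Phi_def sum_unfold_sum_mset act_sum_right)
    also have "\<dots> = (\<Sum>e\<in>B. \<Sum>(p, q)\<in>#\<Delta> h. \<Sum>(p', p'')\<in>#\<Delta> p. act p' (?t e) * act p'' y * act q e)"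
      by (simp add: act_on_mult sum_mset_distrib_right case_prod_unfold)
    also have "\<dots> = (\<Sum>(p, q)\<in>#\<Delta> h. \<Sum>(p', p'')\<in>#\<Delta> p. \<Sum>e\<in>B. act p' (?t e) * act p'' y * act q e)"
      by (simp add: sum_sum_mset_swap case_prod_unfold)
    also have "\<dots> = (\<Sum>(p, q)\<in>#\<Delta> h. \<Sum>(p', p'')\<in>#\<Delta> p. \<Sum>e\<in>B. ?t e * act p'' y * act (q * S p') e)"
      by (simp add: Phi_shift[OF tau])
    also have "\<dots> = (\<Sum>(p, q)\<in>#\<Delta> h. \<Sum>(p', p'')\<in>#\<Delta> p. \<Sum>e\<in>B. ?t e * act p' y * act (q * S p'') e)"
    proof -
      have "(\<Sum>(p', p'')\<in>#\<Delta> p. \<Sum>e\<in>B. ?t e * act p'' y * act (q * S p') e) =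
          (\<Sum>(p', p'')\<in>#\<Delta> p. \<Sum>e\<in>B. ?t e * act p' y * act (q * S p'') e)" for p q
        by (rule H.comult_commute[OF cocomm]) (simp_all add: lin)
      then show ?thesis by simp
    qed
    also have "\<dots> = (\<Sum>(p, q)\<in>#\<Delta> h. \<Sum>(q', q'')\<in>#\<Delta> q. \<Sum>e\<in>B. ?t e * act p y * act (q'' * S q') e)"
      by (rule H.comult_coassoc) (simp_all add: lin)
    also have "\<dots> = (\<Sum>(p, q)\<in>#\<Delta> h. \<Sum>e\<in>B. ?t e * act p y * act (\<Sum>(q', q'')\<in>#\<Delta> q. q'' * S q') e)"
      by (simp add: act_sum_left sum_mset_distrib_left sum_sum_mset_swap case_prod_unfold)
    also have "\<dots> = (\<Sum>(p, q)\<in>#\<Delta> h. \<Sum>e\<in>B. ?t e * act (sH (\<epsilon> q) p) y * e)"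
      by (simp add: H.antipode_right_swapped[OF cocomm] act_scale act_one A.scale_mult_left
          A.scale_mult_right)
    also have "\<dots> = (\<Sum>e\<in>B. ?t e * act (\<Sum>(p, q)\<in>#\<Delta> h. sH (\<epsilon> q) p) y * e)"
      by (simp add: act_sum_left sum_mset_distrib_left sum_mset_distrib_right sum_sum_mset_swap
          case_prod_unfold)
    also have "\<dots> = ?P (act h y)"
      by (simp add: H.counit_right Phi_def)
    finally show ?thesis by simp
  qed
  then show ?thesis
    by (simp add: End_H_def hom_H_def Phi_def distrib_left distrib_right sum.distrib
        A.scale_mult_left A.scale_mult_right A.scale_sum_right)
qed

end

locale galois_invariant_subspace =
  galois_module_algebra sH \<Delta> \<epsilon> S sA act + invariant_subspace sH \<Delta> \<epsilon> S sA act V B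
  for sH :: "'k::field \<Rightarrow> 'h::ring_1 \<Rightarrow> 'h"
    and \<Delta> :: "'h \<Rightarrow> ('h \<times> 'h) multiset"
    and \<epsilon> :: "'h \<Rightarrow> 'k"
    and S :: "'h \<Rightarrow> 'h"
    and sA :: "'k \<Rightarrow> 'a::ring_1 \<Rightarrow> 'a"
    and act :: "'h \<Rightarrow> 'a \<Rightarrow> 'a"
    and V B :: "'a set"
begin

lemma Phi_of_functional:
  assumes t: "galois_map act t = (\<lambda>b. sA (f b) 1)" and v: "v \<in> V"
  obtains \<tau> where "\<tau> \<in> D_dual S sA act V sA act"
    and "\<And>y. Phi sA B \<tau> (\<lambda>v. v) y = (\<Sum>(a, h)\<in>#t. a * y * act h v)"
proof
  let ?\<tau> = "\<lambda>\<xi>. \<Sum>(a, h)\<in>#t. sA (\<xi> (act h v)) a"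
  have scale: "sA c (\<Sum>x\<in>#M. k x) = (\<Sum>x\<in>#M. sA c (k x))" for c k and M :: "('a \<times> 'h) multiset"
    by (rule additive_sum_mset) (rule A.scale_right_distrib)
  have "?\<tau> (dual_action S act V g \<xi>) = act g (?\<tau> \<xi>)" if "\<xi> \<in> dual_space sA V" for g \<xi>
  proof -
    have "?\<tau> (dual_action S act V g \<xi>) = (\<Sum>(a, h)\<in>#t. sA (\<xi> (act (S g * h) v)) a)"
      using invariant[OF v] by (simp add: dual_action_def act_mult)
    also have "\<dots> = act g (?\<tau> \<xi>)"
      by (rule functional_equivariant[OF cocomm t, of "\<lambda>h. \<xi> (act h v)"])
        (use that invariant[OF v] in \<open>auto simp: dual_space_def act_add act_scale\<close>)
    finally show ?thesis .
  qed
  then show "?\<tau> \<in> D_dual S sA act V sA act"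
    by (simp add: D_dual_def hom_H_def A.scale_left_distrib sum_mset.distrib case_prod_unfold scale)
  show "Phi sA B ?\<tau> (\<lambda>v. v) y = (\<Sum>(a, h)\<in>#t. a * y * act h v)" for y
  proof -
    have "Phi sA B ?\<tau> (\<lambda>v. v) y
        = (\<Sum>(a, h)\<in>#t. a * y * (\<Sum>e\<in>B. sA (dual_basis_vector sA B e (act h v)) e))"
      by (simp add: Phi_def sum_mset_distrib_right case_prod_unfold sum_sum_mset_swap
          sum_distrib_left A.scale_mult_left A.scale_mult_right)
    then show ?thesis
      using sum_dual_basis[OF invariant[OF v]] by simp
  qed
qed

text \<open>The identity of \<open>A\<close> is \<open>\<Sum> x \<phi>\<^sub>x\<close> over a finite basis with its coordinate functionals. By
  injectivity of \<open>\<pi>\<close> the corresponding tensor \<open>s\<close> is \<open>1 \<otimes> 1\<close>. The balanced map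
  \<open>a \<otimes> h \<mapsto> a y (h v)\<close> sends \<open>1 \<otimes> 1\<close> to \<open>y v\<close> and \<open>s\<close> to the combination
  \<open>\<Sum> x \<Phi>\<^sub>x(y)\<close>.\<close>

lemma right_mult_eq_Phi_combination:
  assumes v: "v \<in> V"
  obtains m where "\<And>a r. (a, r) \<in># m \<Longrightarrow>
      r \<in> {Phi sA B \<tau> (\<lambda>v. v) |\<tau>. \<tau> \<in> D_dual S sA act V sA act}"
    and "\<And>y. y * v = (\<Sum>(a, r)\<in>#m. a * r y)"
proof -
  let ?Phis = "{Phi sA B \<tau> (\<lambda>v. v) |\<tau>. \<tau> \<in> D_dual S sA act V sA act}"
  obtain X where X: "finite X" "A.independent X" "A.span X = UNIV"
    by (rule finite_basis)
  have "\<exists>t. galois_map act t = (\<lambda>b. sA (A.representation X b x) 1)" for x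
  proof -
    have "Vector_Spaces.linear sA sA (\<lambda>b. sA (A.representation X b x) 1)"
      using X by (simp add: Vector_Spaces.linear_iff A.vector_space_axioms A.representation_add
          A.representation_scale A.scale_left_distrib)
    then show ?thesis
      by (rule galois_map_surj) blast
  qed
  then obtain t where t: "\<And>x. galois_map act (t x) = (\<lambda>b. sA (A.representation X b x) 1)"
    by metis
  have "\<exists>r\<in>?Phis. \<forall>y. r y = (\<Sum>(a, h)\<in>#t x. a * y * act h v)" for x
    by (rule Phi_of_functional[OF t v, of x]) blast
  then obtain r where r: "\<And>x. r x \<in> ?Phis" "\<And>x y. r x y = (\<Sum>(a, h)\<in>#t x. a * y * act h v)"
    by metis
  define s where "s = (\<Sum>x\<in>#mset_set X. image_mset (\<lambda>(a, h). (x * a, h)) (t x))"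
  have "galois_map act s b = galois_map act {#(1, 1)#} b" for b
  proof -
    have "galois_map act s b = (\<Sum>x\<in>X. x * galois_map act (t x) b)"
      by (simp add: s_def galois_map_def sum_image_mset_sum_mset case_prod_unfold
          image_mset.compositionality comp_def sum_unfold_sum_mset sum_mset_distrib_left mult.assoc)
    also have "\<dots> = b"
      using A.sum_representation_eq[of X b X] X by (simp add: t A.scale_mult_right)
    finally show ?thesis
      by (simp add: galois_map_def act_one)
  qed
  then have s: "tensor_eq sA sH s {#(1, 1)#}"
    by (intro galois_map_inj ext)
  show ?thesis
  proof (rule that[of "image_mset (\<lambda>x. (x, r x)) (mset_set X)"])
    fix a q
    assume "(a, q) \<in># image_mset (\<lambda>x. (x, r x)) (mset_set X)"
    then show "q \<in> ?Phis"
      using r(1) by auto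
  next
    fix y
    have "(\<Sum>(a, h)\<in>#s. a * y * act h v) = (\<Sum>(a, h)\<in>#{#(1, 1)#}. a * y * act h v)"
      by (rule tensor_eq_sum_mset[OF s])
        (simp_all add: algebra_simps act_add act_scale A.scale_mult_left A.scale_mult_right)
    then have "y * v = (\<Sum>x\<in>#mset_set X. x * r x y)"
      by (simp add: s_def r(2) sum_image_mset_sum_mset case_prod_unfold
          image_mset.compositionality comp_def sum_mset_distrib_left mult.assoc act_one)
    then show "y * v = (\<Sum>(a, q)\<in>#image_mset (\<lambda>x. (x, r x)) (mset_set X). a * q y)"
      by (simp add: image_mset.compositionality comp_def)
  qed
qed

end

section \<open>Generation of the endomorphism algebra\<close>

theorem proposition4p8:
  fixes sH :: "'k::field \<Rightarrow> 'h::ring_1 \<Rightarrow> 'h"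
    and \<Delta> :: "'h \<Rightarrow> ('h \<times> 'h) multiset"
    and \<epsilon> :: "'h \<Rightarrow> 'k"
    and S :: "'h \<Rightarrow> 'h"
    and sA :: "'k \<Rightarrow> 'a::ring_1 \<Rightarrow> 'a"
    and act :: "'h \<Rightarrow> 'a \<Rightarrow> 'a"
    and V B :: "'a set"
  assumes "hopf_algebra sH \<Delta> \<epsilon> S"
    and "finite_dimensional sH"
    and "cocommutative sH \<Delta>"
    and "module_algebra sH \<Delta> \<epsilon> S sA act"
    and "dual_galois sH sA act"
    and "central_simple sA"
    and "module.subspace sA V"
    and "\<And>h v. v \<in> V \<Longrightarrow> act h v \<in> V"
    and "algebra_generated sA V = UNIV"
    and "\<not> module.dependent sA B" and "module.span sA B = V"
  shows "End_H sA act =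
    operator_algebra_generated sA {Phi sA B \<tau> (\<lambda>v. v) |\<tau>. \<tau> \<in> D_dual S sA act V sA act}"
proof -
  interpret galois_module_algebra sH \<Delta> \<epsilon> S sA act
    using assms(2,4,5) by (simp add: galois_module_algebra_def galois_module_algebra_axioms_def)
  have csa: "central_algebra sA" "simple_algebra sA"
    using assms(6) by (simp_all add: central_simple_def)
  obtain X where X: "finite X" "A.independent X" "A.span X = UNIV"
    by (rule finite_basis)
  have fin: "finite B"
    using A.independent_span_bound[OF X(1), of B] assms(10) X(3) by simp
  interpret galois_invariant_subspace sH \<Delta> \<epsilon> S sA act V B
    using assms(3,8,10,11) fin by unfold_locales
  let ?Phis = "{Phi sA B \<tau> (\<lambda>v. v) |\<tau>. \<tau> \<in> D_dual S sA act V sA act}"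
  define R where "R = operator_algebra_generated sA ?Phis"
  note R_defs = R_def operator_algebra_generated_def
  have R_base: "?Phis \<subseteq> R"
    unfolding R_defs by (blast intro: generated_subalgebra.base)
  have R_id: "id \<in> R"
    unfolding R_defs by (rule generated_subalgebra.one)
  have R_add: "(\<lambda>x. r x + q x) \<in> R" if "r \<in> R" "q \<in> R" for r q
    using that unfolding R_defs by (rule generated_subalgebra.plus)
  have R_comp: "r \<circ> q \<in> R" if "r \<in> R" "q \<in> R" for r q
    using that unfolding R_defs by (rule generated_subalgebra.times)
  have R_scale: "(\<lambda>x. sA c (r x)) \<in> R" if "r \<in> R" for r c
    using that unfolding R_defs by (rule generated_subalgebra.scale)
  have R_End: "R \<subseteq> End_H sA act"
  proof
    fix r assume "r \<in> R"
    then show "r \<in> End_H sA act"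
      unfolding R_defs
    proof (induction rule: generated_subalgebra.induct)
      case (base r)
      then show ?case
        using Phi_in_End_H by blast
    qed (intro End_H_closed; assumption)+
  qed
  \<comment> \<open>\<open>T\<close> is the left \<open>A\<close>-module \<open>A R\<close>.\<close>
  define T where "T = {\<lambda>x. \<Sum>(a, r)\<in>#m. a * r x |m. \<forall>(a, r)\<in>#m. r \<in> R}"
  have T_zero: "(\<lambda>x. 0) \<in> T"
    unfolding T_def by (rule CollectI, rule exI[of _ "{#}"]) simp
  have T_add: "(\<lambda>x. u x + w x) \<in> T" if u: "u \<in> T" and w: "w \<in> T" for u w
  proof -
    obtain m n where "u = (\<lambda>x. \<Sum>(a, r)\<in>#m. a * r x)" "\<forall>(a, r)\<in>#m. r \<in> R"
      "w = (\<lambda>x. \<Sum>(a, r)\<in>#n. a * r x)" "\<forall>(a, r)\<in>#n. r \<in> R"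
      using u w unfolding T_def by blast
    then show ?thesis
      unfolding T_def by (intro CollectI exI[of _ "m + n"]) auto
  qed
  have T_mem: "(\<lambda>x. a * r x) \<in> T" if "r \<in> R" for a r
    unfolding T_def using that by (intro CollectI exI[of _ "{#(a, r)#}"]) auto
  have T_sum: "(\<lambda>x. \<Sum>z\<in>#m. w z x) \<in> T" if "\<And>z. z \<in># m \<Longrightarrow> w z \<in> T" for m :: "('a \<times> ('a \<Rightarrow> 'a)) multiset" and w
    using that by (induction m) (auto intro: T_zero T_add)
  have T_induct: "P u" if mem: "u \<in> T" and "P (\<lambda>x. 0)" and "\<And>u w. P u \<Longrightarrow> P w \<Longrightarrow> P (\<lambda>x. u x + w x)"
    and "\<And>a r. r \<in> R \<Longrightarrow> P (\<lambda>x. a * r x)" for P and u :: "'a \<Rightarrow> 'a"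
  proof -
    obtain m where m: "u = (\<lambda>x. \<Sum>(a, r)\<in>#m. a * r x)" "\<forall>(a, r)\<in>#m. r \<in> R"
      using mem unfolding T_def by blast
    from m(2) have "P (\<lambda>x. \<Sum>(a, r)\<in>#m. a * r x)"
      by (induction m) (use that(2-4) in auto)
    with m(1) show ?thesis by simp
  qed
  have T_left: "(\<lambda>x. b * u x) \<in> T" if "u \<in> T" for b u
    using that
  proof (rule T_induct)
    show "(\<lambda>x. b * 0) \<in> T"
      using T_zero by simp
    show "(\<lambda>x. b * (u x + w x)) \<in> T" if "(\<lambda>x. b * u x) \<in> T" "(\<lambda>x. b * w x) \<in> T" for u w
      using T_add[OF that] by (simp add: distrib_left)
    show "(\<lambda>x. b * (a * r x)) \<in> T" if "r \<in> R" for a r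
      using T_mem[OF that, of "b * a"] by (simp add: mult.assoc)
  qed
  \<comment> \<open>On a generator, \<open>(a r(x)) v = a (r(x) v)\<close>, and \<open>r(x) v\<close> is a combination \<open>\<Sum> b \<Phi>(r(x))\<close>
    whose operators \<open>\<Phi> \<circ> r\<close> are again in \<open>R\<close>.\<close>
  have T_right_V: "(\<lambda>x. u x * v) \<in> T" if u: "u \<in> T" and v: "v \<in> V" for u v
    using u
  proof (rule T_induct)
    show "(\<lambda>x. 0 * v) \<in> T"
      using T_zero by simp
    show "(\<lambda>x. (u x + w x) * v) \<in> T" if "(\<lambda>x. u x * v) \<in> T" "(\<lambda>x. w x * v) \<in> T" for u w
      using T_add[OF that] by (simp add: distrib_right)
    show "(\<lambda>x. a * r x * v) \<in> T" if r: "r \<in> R" for a r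
    proof -
      obtain m where m: "\<And>a r. (a, r) \<in># m \<Longrightarrow> r \<in> ?Phis" "\<And>y. y * v = (\<Sum>(a, r)\<in>#m. a * r y)"
        using right_mult_eq_Phi_combination[OF v] by blast
      have "(\<lambda>x. \<Sum>z\<in>#m. a * (fst z * (snd z \<circ> r) x)) \<in> T"
      proof (rule T_sum)
        fix z assume "z \<in># m"
        then have "snd z \<in> R"
          using m(1)[of "fst z" "snd z"] R_base by auto
        then show "(\<lambda>x. a * (fst z * (snd z \<circ> r) x)) \<in> T"
          by (intro T_left T_mem R_comp r)
      qed
      moreover have "a * r x * v = (\<Sum>z\<in>#m. a * (fst z * (snd z \<circ> r) x))" for x
        using m(2)[of "r x"] by (simp add: mult.assoc case_prod_unfold sum_mset_distrib_left)
      ultimately show ?thesis by simp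
    qed
  qed
  have T_right: "(\<lambda>x. u x * b) \<in> T" if "u \<in> T" for u b
  proof -
    have "b \<in> generated_subalgebra (+) (*) 1 sA V"
      using assms(9) by (simp add: algebra_generated_def)
    then have "\<forall>u\<in>T. (\<lambda>x. u x * b) \<in> T"
    proof (induction rule: generated_subalgebra.induct)
      case (plus x y)
      then show ?case
        by (simp add: distrib_left T_add)
    next
      case (times x y)
      show ?case
      proof
        fix u assume "u \<in> T"
        then have "(\<lambda>z. u z * x) \<in> T" using times by blast
        then have "(\<lambda>z. u z * x * y) \<in> T" by (rule bspec[OF times(4)])
        then show "(\<lambda>z. u z * (x * y)) \<in> T" by (simp add: mult.assoc)
      qed
    next
      case (scale x c)
      show ?case
      proof
        fix u assume "u \<in> T"
        then have "(\<lambda>z. u z * x) \<in> T" using scale by blast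
        then have "(\<lambda>z. sA c 1 * (u z * x)) \<in> T" by (rule T_left)
        then show "(\<lambda>z. u z * sA c x) \<in> T" by (simp add: A.scale_mult_left A.scale_mult_right)
      qed
    qed (simp_all add: T_right_V)
    with that show ?thesis by blast
  qed
  have T_id: "(\<lambda>x. x) \<in> T"
    using T_mem[OF R_id, of 1] by simp
  have lin_End: "Vector_Spaces.linear sA sA e" if "e \<in> End_H sA act" for e
    using that by (simp add: End_H_def hom_H_def Vector_Spaces.linear_iff A.vector_space_axioms)
  have lin_T: "Vector_Spaces.linear sA sA w" if "w \<in> T" for w
    using that
  proof (rule T_induct)
    show "Vector_Spaces.linear sA sA (\<lambda>x. a * r x)" if "r \<in> R" for a r
      using lin_End[of r] R_End that
      by (auto simp: Vector_Spaces.linear_iff distrib_left A.scale_mult_right)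
  qed (simp_all add: Vector_Spaces.linear_iff A.vector_space_axioms algebra_simps A.scale_right_distrib)
  have End_T: "e \<in> T" if "e \<in> End_H sA act" for e
    by (rule A.linear_in_bimodule_operators[OF csa X T_id T_add T_left T_right lin_T lin_End[OF that]])
  have "End_H sA act \<subseteq> R"
  proof
    fix e assume e: "e \<in> End_H sA act"
    obtain m where m: "e = (\<lambda>x. \<Sum>(a, r)\<in>#m. a * r x)" "\<forall>(a, r)\<in>#m. r \<in> R"
      using End_T[OF e] unfolding T_def by blast
    \<comment> \<open>\<open>f\<close> is the coordinate at \<open>1\<close> in a basis of \<open>A\<close> that contains \<open>1\<close>.\<close>
    let ?X1 = "A.extend_basis {1}"
    have one: "A.independent {1}"
      by (simp add: A.dependent_single)
    define f where "f = (\<lambda>a. A.representation ?X1 a 1)"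
    have f: "Vector_Spaces.linear sA (*) f" "f 1 = 1"
      unfolding f_def
      using A.linear_representation[OF A.independent_extend_basis[OF one] A.span_extend_basis[OF one]]
        A.representation_basis[OF A.independent_extend_basis[OF one]] A.extend_basis_superset[OF one]
      by auto
    have "e x = (\<Sum>(a, r)\<in>#m. sA (f a) (r x))" for x
      by (rule descend_coefficients[OF e _ _ f]) (use m R_End in auto)
    moreover have "(\<lambda>x. \<Sum>(a, r)\<in>#m. sA (f a) (r x)) \<in> R"
      using m(2)
    proof (induction m)
      case empty
      then show ?case
        using R_scale[OF R_id, of 0] by simp
    qed (auto intro: R_add R_scale)
    ultimately show "e \<in> R"
      by presburger
  qed
  with R_End show ?thesis
    unfolding R_def by blast
qed

end
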